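(* For every $p\in(1,\infty)$ there exists a real number $C_p>1$ such that for all $d\in\mathbb{N}$ and all $\varepsilon\in(0,1/2)$ we have $$N_p^{{\rm per},+}(\varepsilon,d)\ \ge\ C_p^d\,(1-2\varepsilon).$$ In particular, for all $p\in(1,\infty)$ the periodic $L_p$-discrepancy for non-negative weights suffers from the curse of dimensionality; that is, there exist a fixed $\varepsilon>0$ and a real $C>1$ such that $N_p^{{\rm per},+}(\varepsilon,d)\ge C^d$ for infinitely many $d\in\mathbb{N}$.
   Context: For $x,y\in[0,1]$ set $I(x,y):=[x,y)$ if $x\le y$ and $I(x,y):=[0,y)\cup[x,1)$ if $x>y$. For $\boldsymbol{x},\boldsymbol{y}\in[0,1]^d$ set $B(\boldsymbol{x},\boldsymbol{y}):=I(x_1,y_1)\times\cdots\times I(x_d,y_d)$. For an $N$-element set $\mathcal{P}=\{\boldsymbol{x}_1,\ldots,\boldsymbol{x}_N\}\subset[0,1)^d$ and real weights $\mathcal{A}=\{a_1,\ldots,a_N\}$ (with $a_k$ attached to $\boldsymbol{x}_k$), put $\Delta_{\mathcal{P},\mathcal{A}}(C):=\sum_{k=1}^Na_k\mathbf{1}_C(\boldsymbol{x}_k)-\lambda(C)$ for measurable $C\subseteq[0,1)^d$, where $\lambda$ is the Lebesgue measure. The periodic $L_p$-discrepancy is $$L_{p,N}^{\rm per}(\mathcal{P},\mathcal{A}):=\|(\boldsymbol{x},\boldsymbol{y})\mapsto\Delta_{\mathcal{P},\mathcal{A}}(B(\boldsymbol{x},\boldsymbol{y}))\|_{L_p([0,1]^{2d})}.$$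 For $N\in\mathbb{N}=\{1,2,\ldots\}$ let ${\rm disc}_p^{{\rm per},+}(N,d):=\inf L_{p,N}^{\rm per}(\mathcal{P},\mathcal{A})$, where the infimum is over all $N$-element sets $\mathcal{P}\subset[0,1)^d$ and all non-negative weights $a_1,\ldots,a_N\ge0$. For $p\in(1,\infty)$ the initial periodic $L_p$-discrepancy (the $L_p([0,1]^{2d})$-norm of $(\boldsymbol{x},\boldsymbol{y})\mapsto\lambda(B(\boldsymbol{x},\boldsymbol{y}))$) equals $(p+1)^{-d/p}$, and the inverse of the discrepancy is $$N_p^{{\rm per},+}(\varepsilon,d):=\min\left\{N\in\mathbb{N}:\ {\rm disc}_p^{{\rm per},+}(N,d)\le\frac{\varepsilon}{(p+1)^{d/p}}\right\}.$$ *)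

theory Defs
  imports "HOL-Analysis.Analysis"
begin

text \<open>Points of \<open>d\<close>-dimensional space are extensional functions on \<^term>\<open>{..<d}\<close>, so that
  the dimension can be quantified over inside a formula.\<close>

definition leb :: "nat \<Rightarrow> (nat \<Rightarrow> real) measure"
  where "leb d = Pi\<^sub>M {..<d} (\<lambda>_. lborel)"

definition unit_cube :: "nat \<Rightarrow> (nat \<Rightarrow> real) set"
  where "unit_cube d = Pi\<^sub>E {..<d} (\<lambda>_. {0..1})"

definition half_open_cube :: "nat \<Rightarrow> (nat \<Rightarrow> real) set"
  where "half_open_cube d = Pi\<^sub>E {..<d} (\<lambda>_. {0..<1})"

definition per_interval :: "real \<Rightarrow> real \<Rightarrow> real set"
  where "per_interval x y = (if x \<le> y then {x..<y} else {0..<y} \<union> {x..<1})"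

definition per_box :: "nat \<Rightarrow> (nat \<Rightarrow> real) \<Rightarrow> (nat \<Rightarrow> real) \<Rightarrow> (nat \<Rightarrow> real) set"
  where "per_box d x y = Pi\<^sub>E {..<d} (\<lambda>i. per_interval (x i) (y i))"

text \<open>A weighted point set is a set \<open>P\<close> of points together with a function \<open>a\<close> whose value
  at \<open>z \<in> P\<close> is the weight attached to \<open>z\<close>; values of \<open>a\<close> outside \<open>P\<close> are irrelevant.\<close>

definition local_disc ::
  "nat \<Rightarrow> (nat \<Rightarrow> real) set \<Rightarrow> ((nat \<Rightarrow> real) \<Rightarrow> real) \<Rightarrow> (nat \<Rightarrow> real) set \<Rightarrow> real"
  where "local_disc d P a C = (\<Sum>z\<in>P. a z * indicator C z) - measure (leb d) C"

text \<open>The \<open>L\<^sub>p\<close> norm over \<open>[0,1]\<^sup>2\<^sup>d\<close>, viewed as the product of two copies of \<^term>\<open>unit_cube d\<close>.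
  For finite \<open>P\<close> the integrand is bounded and Borel measurable, so the
  Bochner integral is the true one.\<close>

definition per_disc ::
  "real \<Rightarrow> nat \<Rightarrow> (nat \<Rightarrow> real) set \<Rightarrow> ((nat \<Rightarrow> real) \<Rightarrow> real) \<Rightarrow> real"
  where "per_disc p d P a =
    (LINT (x, y) : unit_cube d \<times> unit_cube d | leb d \<Otimes>\<^sub>M leb d.
       \<bar>local_disc d P a (per_box d x y)\<bar> powr p) powr (1 / p)"

definition min_per_disc_nonneg :: "real \<Rightarrow> nat \<Rightarrow> nat \<Rightarrow> real"
  where "min_per_disc_nonneg p N d =
    Inf {per_disc p d P a | P a.
           P \<subseteq> half_open_cube d \<and> finite P \<and> card P = N \<and> (\<forall>z\<in>P. 0 \<le> a z)}"

text \<open>The minimum is over a nonempty set for \<open>p > 1\<close>, \<open>\<epsilon> > 0\<close>, \<open>d \<ge> 1\<close>: equally weighted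
  regular grids have arbitrarily small discrepancy. The factor \<open>(p + 1)\<^bsup>-d/p\<^esup>\<close> is the
  \<open>L\<^sub>p\<close> norm of \<open>(x, y) \<mapsto> measure (leb d) (per_box d x y)\<close>.\<close>

definition inverse_per_disc_nonneg :: "real \<Rightarrow> real \<Rightarrow> nat \<Rightarrow> nat"
  where "inverse_per_disc_nonneg p \<epsilon> d =
    (LEAST N. 1 \<le> N \<and> min_per_disc_nonneg p N d \<le> \<epsilon> / (p + 1) powr (real d / p))"

definition curse_of_dimensionality :: "(real \<Rightarrow> nat \<Rightarrow> nat) \<Rightarrow> bool"
  where "curse_of_dimensionality n \<longleftrightarrow>
    (\<exists>\<epsilon>>0. \<exists>C>1. infinite {d::nat. 1 \<le> d \<and> real (n \<epsilon> d) \<ge> C ^ d})"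

end

theory Submission
  imports Defs
begin

text \<open>
  If a box \<open>B(x, y)\<close> contains no point of \<open>P\<close>, its local discrepancy is \<open>-\<lambda>(B(x, y))\<close> whatever the
  weights are. For fixed \<open>t \<in> [0,1)\<close> the integral of \<open>\<lambda>(I(x, y))\<^sup>p\<close> over \<open>[0,1]\<^sup>2\<close> is \<open>1/(p+1)\<close>, and the part
  coming from the \<open>(x, y)\<close> with \<open>t \<in> I(x, y)\<close> is \<open>1/(p+2)\<close>, independently of \<open>t\<close>. Taking products over
  the coordinates, the boxes that miss \<open>N\<close> given points contribute at least
  \<open>(p+1)\<^sup>-\<^sup>d - N (p+2)\<^sup>-\<^sup>d\<close> to the \<open>p\<close>-th power of the discrepancy. A discrepancy of at most
  \<open>\<epsilon> (p+1)\<^bsup>-d/p\<^esup>\<close> therefore forces \<open>N \<ge> ((p+2)/(p+1))\<^sup>d (1 - \<epsilon>\<^sup>p)\<close>. Regular grids with equal weights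
  have arbitrarily small discrepancy, so some \<open>N\<close> is admissible and the \<open>LEAST\<close> in the definition of
  the inverse is not a junk value.
\<close>

subsection \<open>Arcs of the circle\<close>

lemma has_integral_powr_shift:
  fixes a b k q :: real
  assumes "a \<le> b" "0 \<le> a + k" "0 < q"
  shows "((\<lambda>u. (u + k) powr q) has_integral
           ((b + k) powr (q + 1) - (a + k) powr (q + 1)) / (q + 1)) {a..b}"
proof -
  have "((\<lambda>u. (u + k) powr q) has_integral
           ((b + k) powr (q + 1) / (q + 1) - (a + k) powr (q + 1) / (q + 1))) {a..b}"
  \<comment> \<open>The base \<open>u + k\<close> may vanish at the left endpoint, where the
    derivative rule for \<open>powr\<close> fails; the interior form asks only for continuity at the
    endpoints.\<close>
  proof (rule fundamental_theorem_of_calculus_interior[OF \<open>a \<le> b\<close>])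
    show "continuous_on {a..b} (\<lambda>u. (u + k) powr (q + 1) / (q + 1))"
      using assms by (intro continuous_intros continuous_on_powr') auto
    show "((\<lambda>u. (u + k) powr (q + 1) / (q + 1)) has_vector_derivative (u + k) powr q) (at u)"
      if "u \<in> {a<..<b}" for u
      using that assms unfolding has_real_derivative_iff_has_vector_derivative[symmetric]
      by (auto intro!: derivative_eq_intros)
  qed
  then show ?thesis by (simp add: diff_divide_distrib)
qed

lemma has_integral_powr_reflect:
  fixes a b k q :: real
  assumes "a \<le> b" "b \<le> k" "0 < q"
  shows "((\<lambda>u. (k - u) powr q) has_integral
           ((k - a) powr (q + 1) - (k - b) powr (q + 1)) / (q + 1)) {a..b}"
proof -
  have "((\<lambda>u. (- u + k) powr q) has_integral
           ((- a + k) powr (q + 1) - (- b + k) powr (q + 1)) / (q + 1)) {- (- a)..- (- b)}"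
    using has_integral_powr_shift[of "- b" "- a" k q] assms
    by (subst has_integral_reflect_real[symmetric]) auto
  then show ?thesis by simp
qed

text \<open>Agreement is required only on the open pieces, so the jumps of \<open>arc_len\<close>
  and of membership in half-open arcs at the breakpoints do not matter.\<close>

lemma has_integral_piecewise:
  fixes f g h :: "real \<Rightarrow> real"
  assumes "a \<le> c" "c \<le> b"
    and "(g has_integral i) {a..c}" "(h has_integral j) {c..b}"
    and "\<And>u. a < u \<Longrightarrow> u < c \<Longrightarrow> f u = g u" "\<And>u. c < u \<Longrightarrow> u < b \<Longrightarrow> f u = h u"
  shows "(f has_integral (i + j)) {a..b}"
proof (rule has_integral_combine[OF assms(1,2)])
  show "(f has_integral i) {a..c}"
    by (rule has_integral_spike_finite[of "{a, c}" _ _ g]) (use assms in auto)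
  show "(f has_integral j) {c..b}"
    by (rule has_integral_spike_finite[of "{c, b}" _ _ h]) (use assms in auto)
qed

text \<open>For \<open>x\<close> and \<open>y\<close> in the unit interval this is the length of the
  arc from \<open>x\<close> to \<open>y\<close> on a circle of circumference 1, that is, the
  Lebesgue measure of \<open>per_interval x y\<close>.\<close>

definition arc_len :: "real \<Rightarrow> real \<Rightarrow> real"
  where "arc_len x y = (if x \<le> y then y - x else 1 - x + y)"

lemma arc_len_bounds:
  assumes "x \<in> {0..1}" "y \<in> {0..1}"
  shows "0 \<le> arc_len x y" "arc_len x y \<le> 1"
  using assms by (auto simp: arc_len_def)

lemma borel_measurable_arc_len:
  "(\<lambda>z. arc_len (fst z) (snd z)) \<in> borel_measurable (borel \<Otimes>\<^sub>M borel)"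
  unfolding arc_len_def by measurable

lemma sets_per_interval [measurable]: "per_interval x y \<in> sets borel"
  by (simp add: per_interval_def)

lemma emeasure_per_interval:
  assumes "x \<in> {0..1}" "y \<in> {0..1}"
  shows "emeasure lborel (per_interval x y) = ennreal (arc_len x y)"
proof (cases "x \<le> y")
  case True
  then show ?thesis by (simp add: per_interval_def arc_len_def)
next
  case False
  then have "emeasure lborel ({0..<y} \<union> {x..<1}) = emeasure lborel {0..<y} + emeasure lborel {x..<1}"
    by (intro plus_emeasure[symmetric]) auto
  with False assms show ?thesis
    by (simp add: per_interval_def arc_len_def flip: ennreal_plus)
qed

text \<open>As \<open>y\<close> runs once round the circle, the arc length from \<open>x\<close>
  sweeps the unit interval once: from \<open>1 - x\<close> up to 1, then from 0 up to
  \<open>1 - x\<close>. The integral is therefore that of \<open>u powr q\<close> over the unit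
  interval.\<close>

lemma has_integral_arc_len_snd:
  fixes q x :: real
  assumes "x \<in> {0..1}" "0 < q"
  shows "((\<lambda>y. arc_len x y powr q) has_integral 1 / (q + 1)) {0..1}"
proof -
  have "((\<lambda>y. arc_len x y powr q) has_integral
      ((x + (1 - x)) powr (q + 1) - (0 + (1 - x)) powr (q + 1)) / (q + 1) +
      ((1 + (- x)) powr (q + 1) - (x + (- x)) powr (q + 1)) / (q + 1)) {0..1}"
    using assms
    by (intro has_integral_piecewise[OF _ _ has_integral_powr_shift has_integral_powr_shift])
      (auto simp: arc_len_def algebra_simps)
  moreover have "((x + (1 - x)) powr (q + 1) - (0 + (1 - x)) powr (q + 1)) / (q + 1) +
      ((1 + (- x)) powr (q + 1) - (x + (- x)) powr (q + 1)) / (q + 1) = 1 / (q + 1)"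
    by (simp add: diff_divide_distrib)
  ultimately show ?thesis by simp
qed

text \<open>The same sweep with the end of the arc fixed and its start moving, so both pieces are
  decreasing in \<open>x\<close>.\<close>

lemma has_integral_arc_len_fst:
  fixes q t :: real
  assumes "t \<in> {0..1}" "0 < q"
  shows "((\<lambda>x. arc_len x t powr q) has_integral 1 / (q + 1)) {0..1}"
proof -
  have "((\<lambda>x. arc_len x t powr q) has_integral
      ((t - 0) powr (q + 1) - (t - t) powr (q + 1)) / (q + 1) +
      ((1 + t - t) powr (q + 1) - (1 + t - 1) powr (q + 1)) / (q + 1)) {0..1}"
    using assms
    by (intro has_integral_piecewise[OF _ _ has_integral_powr_reflect has_integral_powr_reflect])
      (auto simp: arc_len_def algebra_simps)
  moreover have "((t - 0) powr (q + 1) - (t - t) powr (q + 1)) / (q + 1) +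
      ((1 + t - t) powr (q + 1) - (1 + t - 1) powr (q + 1)) / (q + 1) = 1 / (q + 1)"
    by (simp add: diff_divide_distrib)
  ultimately show ?thesis by simp
qed

text \<open>The arc from \<open>x\<close> to \<open>y\<close> contains \<open>t\<close> exactly when
  it is longer than the arc from \<open>x\<close> to \<open>t\<close>, so this is the integral of
  \<open>u powr q\<close> from \<open>arc_len x t\<close> to 1.\<close>

lemma has_integral_arc_len_containing:
  fixes q x t :: real
  assumes "x \<in> {0..1}" "t \<in> {0..<1}" "0 < q"
  shows "((\<lambda>y. indicator (per_interval x y) t * arc_len x y powr q) has_integral
            (1 - arc_len x t powr (q + 1)) / (q + 1)) {0..1}"
proof (cases "x \<le> t")
  case True
  \<comment> \<open>Three pieces: for \<open>y < x\<close> the arc wraps round and contains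
    \<open>t\<close>, for \<open>y\<close> between \<open>x\<close> and \<open>t\<close> it stops
    too early, and beyond \<open>t\<close> it contains \<open>t\<close> again.\<close>
  have "((\<lambda>y. indicator (per_interval x y) t * arc_len x y powr q) has_integral
      ((x + (1 - x)) powr (q + 1) - (0 + (1 - x)) powr (q + 1)) / (q + 1) +
      (0 + ((1 + (- x)) powr (q + 1) - (t + (- x)) powr (q + 1)) / (q + 1))) {0..1}"
    using assms True
    by (intro has_integral_piecewise[OF _ _ has_integral_powr_shift
          has_integral_piecewise[OF _ _ has_integral_0 has_integral_powr_shift, of x t 1]])
      (auto simp: arc_len_def per_interval_def algebra_simps split: split_indicator)
  moreover have "((x + (1 - x)) powr (q + 1) - (0 + (1 - x)) powr (q + 1)) / (q + 1) +
      (0 + ((1 + (- x)) powr (q + 1) - (t + (- x)) powr (q + 1)) / (q + 1))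
      = (1 - arc_len x t powr (q + 1)) / (q + 1)"
    using True by (simp add: arc_len_def diff_divide_distrib)
  ultimately show ?thesis by simp
next
  case False
  \<comment> \<open>Now \<open>t < x\<close>, so only an arc that wraps round and ends strictly
    between \<open>t\<close> and \<open>x\<close> contributes.\<close>
  have "((\<lambda>y. indicator (per_interval x y) t * arc_len x y powr q) has_integral
      0 + (((x + (1 - x)) powr (q + 1) - (t + (1 - x)) powr (q + 1)) / (q + 1) + 0)) {0..1}"
    using assms False
    by (intro has_integral_piecewise[OF _ _ has_integral_0
          has_integral_piecewise[OF _ _ has_integral_powr_shift has_integral_0, of t x 1]])
      (auto simp: arc_len_def per_interval_def algebra_simps split: split_indicator)
  moreover have "0 + (((x + (1 - x)) powr (q + 1) - (t + (1 - x)) powr (q + 1)) / (q + 1) + 0)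
      = (1 - arc_len x t powr (q + 1)) / (q + 1)"
    using False by (simp add: arc_len_def algebra_simps)
  ultimately show ?thesis by (simp only:)
qed

text \<open>The inner integral is the same for every \<open>x\<close> in the unit interval. The
  domain enters through indicators to match the hypothesis of
  \<open>nn_integral_unit_cube_square_prod\<close>.\<close>

lemma nn_integral_arc_len:
  fixes q :: real
  assumes "0 < q"
  shows "(\<integral>\<^sup>+x. \<integral>\<^sup>+y. ennreal (indicator {0..1} x * indicator {0..1} y * arc_len x y powr q)
           \<partial>lborel \<partial>lborel) = ennreal (1 / (q + 1))"
proof -
  have "(\<integral>\<^sup>+y. ennreal (indicator {0..1} x * indicator {0..1} y * arc_len x y powr q) \<partial>lborel)
      = ennreal (indicator {0..1} x * (1 / (q + 1)))" for x
    using nn_integral_has_integral_lebesgue[OF _ has_integral_arc_len_snd[OF _ assms, of x]]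
    by (cases "x \<in> {0..1}") auto
  moreover have "((\<lambda>x::real. 1 / (q + 1)) has_integral 1 / (q + 1)) {0..1}"
    using has_integral_const_real[of "1 / (q + 1)" 0 1] by simp
  ultimately show ?thesis
    using nn_integral_has_integral_lebesgue[of "{0..1::real}" "\<lambda>_. 1 / (q + 1)" "1 / (q + 1)"] assms
    by simp
qed

text \<open>By rotation invariance a proportion \<open>l\<close> of the arcs of length
  \<open>l\<close> contains \<open>t\<close>, so the value is the moment of order
  \<open>q + 1\<close>. The proof integrates over \<open>y\<close> first and then applies
  \<open>has_integral_arc_len_fst\<close> with exponent \<open>q + 1\<close>.\<close>

lemma nn_integral_arc_len_containing:
  fixes q t :: real
  assumes "0 < q" "t \<in> {0..<1}"
  shows "(\<integral>\<^sup>+x. \<integral>\<^sup>+y. ennreal (indicator {0..1} x * indicator {0..1} y *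
             (indicator (per_interval x y) t * arc_len x y powr q)) \<partial>lborel \<partial>lborel)
           = ennreal (1 / (q + 2))"
proof -
  let ?h = "\<lambda>x. (1 - arc_len x t powr (q + 1)) / (q + 1)"
  have "(\<integral>\<^sup>+y. ennreal (indicator {0..1} x * indicator {0..1} y *
             (indicator (per_interval x y) t * arc_len x y powr q)) \<partial>lborel)
      = ennreal (indicator {0..1} x * ?h x)" for x
    using nn_integral_has_integral_lebesgue[OF _ has_integral_arc_len_containing[of x t q]] assms
    by (cases "x \<in> {0..1}") auto
  moreover have "(?h has_integral (1 - 1 / (q + 1 + 1)) / (q + 1)) {0..1}"
    using has_integral_const_real[of "1::real" 0 1] assms
    by (intro has_integral_divide has_integral_diff has_integral_arc_len_fst) auto
  moreover have "(1 - 1 / (q + 1 + 1)) / (q + 1) = 1 / (q + 2)"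
    using assms by (simp add: divide_simps) (simp add: mult.commute add.commute)
  moreover have "0 \<le> ?h x" if "x \<in> {0..1}" for x
    using arc_len_bounds[OF that, of t] assms
    by (auto intro!: divide_nonneg_nonneg powr_le1)
  ultimately show ?thesis
    using nn_integral_has_integral_lebesgue[of "{0..1::real}" ?h "1 / (q + 2)"]
    by simp
qed

subsection \<open>Integration over pairs of points\<close>

interpretation lborel_PiM: product_sigma_finite "\<lambda>_::nat. lborel :: real measure" ..

lemma sigma_finite_leb: "sigma_finite_measure (leb d)"
  unfolding leb_def by (rule lborel_PiM.sigma_finite) simp

lemma measurable_leb_component:
  "i < d \<Longrightarrow> (\<lambda>x. x i) \<in> borel_measurable (leb d)"
  unfolding leb_def by measurable

lemma measurable_leb_pair_component:
  assumes "i < d" "(\<lambda>z. f (fst z) (snd z)) \<in> measurable (borel \<Otimes>\<^sub>M borel) M"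
  shows "(\<lambda>z. f (fst z i) (snd z i)) \<in> measurable (leb d \<Otimes>\<^sub>M leb d) M"
proof -
  have "(\<lambda>z. (fst z i, snd z i)) \<in> leb d \<Otimes>\<^sub>M leb d \<rightarrow>\<^sub>M borel \<Otimes>\<^sub>M borel"
    by (intro measurable_Pair measurable_compose[OF measurable_fst measurable_leb_component]
        measurable_compose[OF measurable_snd measurable_leb_component] assms(1))
  from measurable_compose[OF this assms(2)] show ?thesis by simp
qed

lemma emeasure_leb_PiE:
  assumes "\<And>i. i < d \<Longrightarrow> A i \<in> sets borel"
  shows "emeasure (leb d) (Pi\<^sub>E {..<d} A) = (\<Prod>i<d. emeasure lborel (A i))"
  unfolding leb_def using assms by (intro lborel_PiM.emeasure_PiM) auto

lemma sets_unit_cube [measurable]: "unit_cube d \<in> sets (leb d)"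
  unfolding unit_cube_def leb_def by (rule sets_PiM_I_finite) auto

lemma emeasure_unit_cube_square:
  "emeasure (leb d \<Otimes>\<^sub>M leb d) (unit_cube d \<times> unit_cube d) = 1"
proof -
  have "emeasure (leb d) (unit_cube d) = 1"
    unfolding unit_cube_def by (subst emeasure_leb_PiE) auto
  then show ?thesis
    by (subst sigma_finite_measure.emeasure_pair_measure_Times[OF sigma_finite_leb]) auto
qed

lemma arc_len_unit_cube_bounds:
  assumes "x \<in> unit_cube d" "y \<in> unit_cube d" "i < d"
  shows "0 \<le> arc_len (x i) (y i)" "arc_len (x i) (y i) \<le> 1"
  using assms by (auto simp: unit_cube_def dest: PiE_mem intro: arc_len_bounds)

lemma measure_per_box:
  assumes "x \<in> unit_cube d" "y \<in> unit_cube d"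
  shows "measure (leb d) (per_box d x y) = (\<Prod>i<d. arc_len (x i) (y i))"
proof -
  have "emeasure (leb d) (per_box d x y) = (\<Prod>i<d. emeasure lborel (per_interval (x i) (y i)))"
    unfolding per_box_def by (rule emeasure_leb_PiE) simp
  also have "\<dots> = (\<Prod>i<d. ennreal (arc_len (x i) (y i)))"
  proof (rule prod.cong[OF refl])
    fix i assume "i \<in> {..<d}"
    then have "x i \<in> {0..1}" "y i \<in> {0..1}"
      using assms by (auto simp only: unit_cube_def dest: PiE_mem)
    then show "emeasure lborel (per_interval (x i) (y i)) = ennreal (arc_len (x i) (y i))"
      by (rule emeasure_per_interval)
  qed
  also have "\<dots> = ennreal (\<Prod>i<d. arc_len (x i) (y i))"
    by (rule prod_ennreal) (simp add: arc_len_unit_cube_bounds[OF assms])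
  finally show ?thesis
    by (rule measure_eq_emeasure_eq_ennreal[rotated])
      (rule prod_nonneg, simp add: arc_len_unit_cube_bounds[OF assms])
qed

text \<open>Membership in \<open>Pi\<^sub>E I A\<close> also fixes the values off \<open>I\<close>,
  which the product over \<open>I\<close> cannot see; extensionality of \<open>z\<close> supplies
  them.\<close>

lemma indicator_PiE:
  assumes "finite I" "z \<in> extensional I"
  shows "indicator (Pi\<^sub>E I A) z = (\<Prod>i\<in>I. indicator (A i) (z i) :: real)"
proof (cases "z \<in> Pi\<^sub>E I A")
  case True
  then have "(\<Prod>i\<in>I. indicator (A i) (z i) :: real) = (\<Prod>i\<in>I. 1)"
    by (intro prod.cong) (auto dest: PiE_mem)
  with True show ?thesis by simp
next
  case False
  then have "\<exists>i\<in>I. indicator (A i) (z i) = (0 :: real)"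
    using assms by (auto simp: PiE_iff indicator_def)
  with False show ?thesis
    using assms by (simp add: prod_zero_iff)
qed

text \<open>Tonelli separates the two points; the product formula is then applied to the coordinates
  of \<open>y\<close> with \<open>x\<close> fixed, and afterwards to those of
  \<open>x\<close>.\<close>

lemma nn_integral_leb_pair_prod:
  fixes f :: "nat \<Rightarrow> real \<Rightarrow> real \<Rightarrow> ennreal"
  assumes "\<And>i. (\<lambda>z. f i (fst z) (snd z)) \<in> borel_measurable (borel \<Otimes>\<^sub>M borel)"
  shows "(\<integral>\<^sup>+z. (\<Prod>i<d. f i (fst z i) (snd z i)) \<partial>(leb d \<Otimes>\<^sub>M leb d))
           = (\<Prod>i<d. \<integral>\<^sup>+x. \<integral>\<^sup>+y. f i x y \<partial>lborel \<partial>lborel)"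
proof -
  have "(\<lambda>(x, y). f i x y) \<in> borel_measurable (borel \<Otimes>\<^sub>M borel)" for i
    using assms[of i] by (simp only: case_prod_beta')
  then have pair: "(\<lambda>(x, y). f i x y) \<in> borel_measurable (lborel \<Otimes>\<^sub>M lborel)" for i
    by (simp add: measurable_cong_sets[OF sets_pair_measure_cong[OF sets_lborel sets_lborel] refl])
  have snd: "f i x \<in> borel_measurable lborel" for i x
    using measurable_Pair2[OF pair, of x] by simp
  have fst: "(\<lambda>x. \<integral>\<^sup>+y. f i x y \<partial>lborel) \<in> borel_measurable lborel" for i
    by (rule lborel.borel_measurable_nn_integral[OF pair])
  have "(\<integral>\<^sup>+z. (\<Prod>i<d. f i (fst z i) (snd z i)) \<partial>(leb d \<Otimes>\<^sub>M leb d))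
      = (\<integral>\<^sup>+x. \<integral>\<^sup>+y. (\<Prod>i<d. f i (x i) (y i)) \<partial>leb d \<partial>leb d)"
  proof (subst sigma_finite_measure.nn_integral_fst[OF sigma_finite_leb, symmetric])
    show "(\<lambda>z. \<Prod>i<d. f i (fst z i) (snd z i)) \<in> borel_measurable (leb d \<Otimes>\<^sub>M leb d)"
      using assms by (intro borel_measurable_prod_ennreal measurable_leb_pair_component) auto
  qed simp
  also have "\<dots> = (\<integral>\<^sup>+x. (\<Prod>i<d. \<integral>\<^sup>+y. f i (x i) y \<partial>lborel) \<partial>leb d)"
    unfolding leb_def by (intro nn_integral_cong lborel_PiM.product_nn_integral_prod snd) simp
  also have "\<dots> = (\<Prod>i<d. \<integral>\<^sup>+x. \<integral>\<^sup>+y. f i x y \<partial>lborel \<partial>lborel)"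
    unfolding leb_def by (intro lborel_PiM.product_nn_integral_prod fst) simp
  finally show ?thesis .
qed

lemma nn_integral_unit_cube_square_prod:
  fixes f :: "nat \<Rightarrow> real \<Rightarrow> real \<Rightarrow> real"
  assumes meas: "\<And>i. (\<lambda>z. f i (fst z) (snd z)) \<in> borel_measurable (borel \<Otimes>\<^sub>M borel)"
    and nonneg: "\<And>i x y. 0 \<le> f i x y"
    and int: "\<And>i. i < d \<Longrightarrow> (\<integral>\<^sup>+x. \<integral>\<^sup>+y.
           ennreal (indicator {0..1} x * indicator {0..1} y * f i x y) \<partial>lborel \<partial>lborel) = ennreal c"
    and "0 \<le> c"
  shows "(\<integral>\<^sup>+z. ennreal (indicator (unit_cube d \<times> unit_cube d) z *
             (\<Prod>i<d. f i (fst z i) (snd z i))) \<partial>(leb d \<Otimes>\<^sub>M leb d)) = ennreal (c ^ d)"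
proof -
  let ?g = "\<lambda>i x y. ennreal (indicator {0..1} x * indicator {0..1} y * f i x y)"
  have "(\<integral>\<^sup>+z. ennreal (indicator (unit_cube d \<times> unit_cube d) z *
             (\<Prod>i<d. f i (fst z i) (snd z i))) \<partial>(leb d \<Otimes>\<^sub>M leb d))
      = (\<integral>\<^sup>+z. (\<Prod>i<d. ?g i (fst z i) (snd z i)) \<partial>(leb d \<Otimes>\<^sub>M leb d))"
  proof (rule nn_integral_cong)
    \<comment> \<open>Points of the space are extensional, so the indicator of the square splits
      over the coordinates at every \<open>z\<close>, inside the square or not.\<close>
    fix z assume "z \<in> space (leb d \<Otimes>\<^sub>M leb d)"
    then have "fst z \<in> extensional {..<d}" "snd z \<in> extensional {..<d}"
      by (auto simp: space_pair_measure leb_def space_PiM PiE_def)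
    then have "indicator (unit_cube d \<times> unit_cube d) z =
        (\<Prod>i<d. indicator {0..1} (fst z i)) * (\<Prod>i<d. indicator {0..1} (snd z i) :: real)"
      by (simp add: indicator_times unit_cube_def indicator_PiE)
    then show "ennreal (indicator (unit_cube d \<times> unit_cube d) z *
          (\<Prod>i<d. f i (fst z i) (snd z i))) = (\<Prod>i<d. ?g i (fst z i) (snd z i))"
      using nonneg by (simp add: prod_ennreal prod.distrib)
  qed
  also have "\<dots> = (\<Prod>i<d. \<integral>\<^sup>+x. \<integral>\<^sup>+y. ?g i x y \<partial>lborel \<partial>lborel)"
    by (intro nn_integral_leb_pair_prod measurable_compose[OF _ measurable_ennreal]
        borel_measurable_times meas) measurable
  also have "\<dots> = ennreal c ^ d"
    using int by simp
  finally show ?thesis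
    using \<open>0 \<le> c\<close> by (simp add: ennreal_power)
qed

subsection \<open>Boxes without points\<close>

text \<open>For \<open>w\<close> extensional on \<open>{..<d}\<close> this is the indicator of
  \<open>per_box d (fst z) (snd z)\<close> at \<open>w\<close>, in a form that factors over the
  coordinates.\<close>

definition box_hit :: "nat \<Rightarrow> (nat \<Rightarrow> real) \<Rightarrow> (nat \<Rightarrow> real) \<times> (nat \<Rightarrow> real) \<Rightarrow> real"
  where "box_hit d w z = (\<Prod>i<d. indicator (per_interval (fst z i) (snd z i)) (w i))"

definition box_volume :: "nat \<Rightarrow> (nat \<Rightarrow> real) \<times> (nat \<Rightarrow> real) \<Rightarrow> real"
  where "box_volume d z = (\<Prod>i<d. arc_len (fst z i) (snd z i))"

text \<open>On \<^term>\<open>unit_cube d \<times> unit_cube d\<close> this is the local discrepancy of the box; unlike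
  \<^const>\<open>local_disc\<close> it is visibly measurable on the whole product space.\<close>

definition box_disc ::
  "nat \<Rightarrow> (nat \<Rightarrow> real) set \<Rightarrow> ((nat \<Rightarrow> real) \<Rightarrow> real) \<Rightarrow> (nat \<Rightarrow> real) \<times> (nat \<Rightarrow> real) \<Rightarrow> real"
  where "box_disc d P a z = (\<Sum>w\<in>P. a w * box_hit d w z) - box_volume d z"

text \<open>The set itself varies with \<open>z\<close>, so membership of \<open>t\<close> is first
  rewritten as comparisons between \<open>t\<close> and the two endpoints.\<close>

lemma borel_measurable_indicator_per_interval:
  "(\<lambda>z. indicator (per_interval (fst z) (snd z)) t :: real) \<in> borel_measurable (borel \<Otimes>\<^sub>M borel)"
proof -
  have "(\<lambda>z. indicator (per_interval (fst z) (snd z)) t :: real) =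
    (\<lambda>z. if (if fst z \<le> snd z then fst z \<le> t \<and> t < snd z
             else 0 \<le> t \<and> t < snd z \<or> fst z \<le> t \<and> t < 1) then 1 else 0)"
    by (auto simp: per_interval_def)
  then show ?thesis by simp
qed

lemma borel_measurable_box_hit [measurable]:
  "box_hit d w \<in> borel_measurable (leb d \<Otimes>\<^sub>M leb d)"
  unfolding box_hit_def
  by (intro borel_measurable_prod measurable_leb_pair_component
      borel_measurable_indicator_per_interval) simp

lemma borel_measurable_box_volume [measurable]:
  "box_volume d \<in> borel_measurable (leb d \<Otimes>\<^sub>M leb d)"
  unfolding box_volume_def
  by (intro borel_measurable_prod measurable_leb_pair_component borel_measurable_arc_len) simp

lemma borel_measurable_box_disc [measurable]:
  "box_disc d P a \<in> borel_measurable (leb d \<Otimes>\<^sub>M leb d)"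
  unfolding box_disc_def by measurable

lemma box_hit_01: "box_hit d w z \<in> {0, 1}"
proof (cases "\<forall>i<d. w i \<in> per_interval (fst z i) (snd z i)")
  case True
  then show ?thesis by (simp add: box_hit_def)
next
  case False
  then show ?thesis by (auto simp: box_hit_def prod_zero_iff indicator_def)
qed

lemma box_volume_bounds:
  assumes "z \<in> unit_cube d \<times> unit_cube d"
  shows "0 \<le> box_volume d z" "box_volume d z \<le> 1"
proof -
  have "0 \<le> arc_len (fst z i) (snd z i)" "arc_len (fst z i) (snd z i) \<le> 1" if "i < d" for i
    using arc_len_unit_cube_bounds[of "fst z" d "snd z" i] assms that by (simp_all add: mem_Times_iff)
  then show "0 \<le> box_volume d z" "box_volume d z \<le> 1"
    unfolding box_volume_def by (intro prod_nonneg prod_le_1; simp)+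
qed

lemma local_disc_per_box:
  assumes "x \<in> unit_cube d" "y \<in> unit_cube d" "P \<subseteq> half_open_cube d"
  shows "local_disc d P a (per_box d x y) = box_disc d P a (x, y)"
proof -
  have "indicator (per_box d x y) w = box_hit d w (x, y)" if "w \<in> P" for w
  proof -
    have "w \<in> extensional {..<d}"
      using assms(3) that by (auto simp: half_open_cube_def PiE_def)
    then show ?thesis
      unfolding per_box_def box_hit_def by (simp only: indicator_PiE finite_lessThan fst_conv snd_conv)
  qed
  then have "(\<Sum>w\<in>P. a w * indicator (per_box d x y) w) = (\<Sum>w\<in>P. a w * box_hit d w (x, y))"
    by (intro sum.cong) simp_all
  then show ?thesis
    unfolding local_disc_def box_disc_def box_volume_def measure_per_box[OF assms(1,2)]
    by (simp only: fst_conv snd_conv)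
qed

text \<open>The two integrands agree at every point: on the square by
  \<open>local_disc_per_box\<close>, outside it because both vanish.\<close>

lemma per_disc_eq:
  assumes "P \<subseteq> half_open_cube d"
  shows "per_disc p d P a = (\<integral>z. indicator (unit_cube d \<times> unit_cube d) z * \<bar>box_disc d P a z\<bar> powr p
           \<partial>(leb d \<Otimes>\<^sub>M leb d)) powr (1 / p)"
proof -
  have "indicator (unit_cube d \<times> unit_cube d) z *\<^sub>R
      (case z of (x, y) \<Rightarrow> \<bar>local_disc d P a (per_box d x y)\<bar> powr p)
    = indicator (unit_cube d \<times> unit_cube d) z * \<bar>box_disc d P a z\<bar> powr p" for z
    using local_disc_per_box[OF _ _ assms]
    by (cases "z \<in> unit_cube d \<times> unit_cube d") (auto simp: mem_Times_iff case_prod_beta')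
  then show ?thesis
    by (simp only: per_disc_def set_lebesgue_integral_def)
qed

text \<open>A bounded measurable function on a set of measure 1. This rules out the default value 0
  of the Bochner integral and allows passing to nonnegative integrals.\<close>

lemma integrable_box_disc_powr:
  assumes "finite P" "0 \<le> p"
  shows "integrable (leb d \<Otimes>\<^sub>M leb d)
           (\<lambda>z. indicator (unit_cube d \<times> unit_cube d) z * \<bar>box_disc d P a z\<bar> powr p)"
proof (rule integrableI_bounded_set)
  show "AE z in leb d \<Otimes>\<^sub>M leb d. z \<in> unit_cube d \<times> unit_cube d \<longrightarrow>
      norm (indicator (unit_cube d \<times> unit_cube d) z * \<bar>box_disc d P a z\<bar> powr p)
        \<le> ((\<Sum>w\<in>P. \<bar>a w\<bar>) + 1) powr p"
  proof (rule AE_I2, rule impI)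
    fix z assume z: "z \<in> unit_cube d \<times> unit_cube d"
    have "\<bar>\<Sum>w\<in>P. a w * box_hit d w z\<bar> \<le> (\<Sum>w\<in>P. \<bar>a w * box_hit d w z\<bar>)"
      by (rule sum_abs)
    also have "\<dots> \<le> (\<Sum>w\<in>P. \<bar>a w\<bar>)"
    proof (rule sum_mono)
      show "\<bar>a w * box_hit d w z\<bar> \<le> \<bar>a w\<bar>" for w
        using box_hit_01[of d w z] by auto
    qed
    finally have "\<bar>box_disc d P a z\<bar> \<le> (\<Sum>w\<in>P. \<bar>a w\<bar>) + 1"
      using box_volume_bounds[OF z] unfolding box_disc_def by linarith
    then show "norm (indicator (unit_cube d \<times> unit_cube d) z * \<bar>box_disc d P a z\<bar> powr p)
        \<le> ((\<Sum>w\<in>P. \<bar>a w\<bar>) + 1) powr p"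
      using z \<open>0 \<le> p\<close> by (simp add: powr_mono2)
  qed
qed (auto simp: emeasure_unit_cube_square)

lemma integral_box_disc_powr_ge:
  assumes "P \<subseteq> half_open_cube d" "finite P" "0 < p"
  shows "(1 / (p + 1)) ^ d - real (card P) * (1 / (p + 2)) ^ d \<le>
           (\<integral>z. indicator (unit_cube d \<times> unit_cube d) z * \<bar>box_disc d P a z\<bar> powr p
             \<partial>(leb d \<Otimes>\<^sub>M leb d))"
    (is "_ \<le> ?D")
proof -
  let ?Q = "unit_cube d \<times> unit_cube d" and ?M = "leb d \<Otimes>\<^sub>M leb d"
  have "ennreal ((1 / (p + 1)) ^ d) =
      (\<integral>\<^sup>+z. ennreal (indicator ?Q z * (\<Prod>i<d. arc_len (fst z i) (snd z i) powr p)) \<partial>?M)"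
    using assms
    by (intro nn_integral_unit_cube_square_prod[symmetric] nn_integral_arc_len
        powr_real_measurable borel_measurable_arc_len) auto
  also have "\<dots> = (\<integral>\<^sup>+z. ennreal (indicator ?Q z * box_volume d z powr p) \<partial>?M)"
    by (simp add: box_volume_def prod_powr_distrib)
  \<comment> \<open>A union bound: each box either misses \<open>P\<close> or is counted by at least
    one of the hit terms. Nonnegative integrals let the right side be split using measurability
    alone.\<close>
  also have "\<dots> \<le> (\<integral>\<^sup>+z. ennreal (indicator ?Q z * \<bar>box_disc d P a z\<bar> powr p) +
        (\<Sum>w\<in>P. ennreal (indicator ?Q z * (box_hit d w z * box_volume d z powr p))) \<partial>?M)"
  proof (rule nn_integral_mono)
    fix z
    have hit_nonneg: "0 \<le> box_hit d w z" for w
      using box_hit_01[of d w z] by auto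
    have "box_volume d z powr p \<le>
        \<bar>box_disc d P a z\<bar> powr p + (\<Sum>w\<in>P. box_hit d w z * box_volume d z powr p)" if "z \<in> ?Q"
    proof (cases "\<exists>w\<in>P. box_hit d w z = 1")
      case True
      then obtain w where w: "w \<in> P" "box_hit d w z = 1" by blast
      then have "box_volume d z powr p \<le> (\<Sum>w\<in>P. box_hit d w z * box_volume d z powr p)"
        using member_le_sum[of w P "\<lambda>w. box_hit d w z * box_volume d z powr p"] assms(2) hit_nonneg
        by simp
      then show ?thesis by (simp add: add_increasing)
    next
      case False
      \<comment> \<open>No point is hit, so the weighted sum vanishes and the local discrepancy is
        minus the volume.\<close>
      then have "box_hit d w z = 0" if "w \<in> P" for w
        using box_hit_01[of d w z] that by auto
      then have "\<bar>box_disc d P a z\<bar> = box_volume d z"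
        using box_volume_bounds[OF that] by (simp add: box_disc_def)
      then show ?thesis
        using hit_nonneg by (simp add: sum_nonneg)
    qed
    then show "ennreal (indicator ?Q z * box_volume d z powr p) \<le>
        ennreal (indicator ?Q z * \<bar>box_disc d P a z\<bar> powr p) +
        (\<Sum>w\<in>P. ennreal (indicator ?Q z * (box_hit d w z * box_volume d z powr p)))"
      using hit_nonneg
      by (cases "z \<in> ?Q") (auto simp: sum_ennreal sum_nonneg simp flip: ennreal_plus)
  qed
  also have "\<dots> = (\<integral>\<^sup>+z. ennreal (indicator ?Q z * \<bar>box_disc d P a z\<bar> powr p) \<partial>?M) +
      (\<Sum>w\<in>P. \<integral>\<^sup>+z. ennreal (indicator ?Q z * (box_hit d w z * box_volume d z powr p)) \<partial>?M)"
    by (subst nn_integral_add) (auto simp: nn_integral_sum)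
  also have "(\<integral>\<^sup>+z. ennreal (indicator ?Q z * \<bar>box_disc d P a z\<bar> powr p) \<partial>?M) = ennreal ?D"
    using assms by (intro nn_integral_eq_integral integrable_box_disc_powr) auto
  also have "(\<Sum>w\<in>P. \<integral>\<^sup>+z. ennreal (indicator ?Q z * (box_hit d w z * box_volume d z powr p)) \<partial>?M)
      = (\<Sum>w\<in>P. ennreal ((1 / (p + 2)) ^ d))"
  proof (rule sum.cong[OF refl])
    fix w assume "w \<in> P"
    then have w: "w i \<in> {0..<1}" if "i < d" for i
      using assms(1) that by (auto simp: half_open_cube_def PiE_iff)
    have "(\<integral>\<^sup>+z. ennreal (indicator ?Q z * (box_hit d w z * box_volume d z powr p)) \<partial>?M) =
        (\<integral>\<^sup>+z. ennreal (indicator ?Q z * (\<Prod>i<d. indicator (per_interval (fst z i) (snd z i)) (w i) *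
            arc_len (fst z i) (snd z i) powr p)) \<partial>?M)"
      by (simp add: box_hit_def box_volume_def prod_powr_distrib prod.distrib)
    also have "\<dots> = ennreal ((1 / (p + 2)) ^ d)"
      using assms w
      by (intro nn_integral_unit_cube_square_prod nn_integral_arc_len_containing
          borel_measurable_times powr_real_measurable borel_measurable_arc_len
          borel_measurable_indicator_per_interval) auto
    finally show "(\<integral>\<^sup>+z. ennreal (indicator ?Q z * (box_hit d w z * box_volume d z powr p)) \<partial>?M)
        = ennreal ((1 / (p + 2)) ^ d)" .
  qed
  also have "ennreal ?D + (\<Sum>w\<in>P. ennreal ((1 / (p + 2)) ^ d)) =
      ennreal (?D + real (card P) * (1 / (p + 2)) ^ d)"
    using assms by (subst sum_ennreal) (auto simp flip: ennreal_plus)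
  \<comment> \<open>The hit terms are moved to the left only after returning to the reals, since
    subtraction in \<open>ennreal\<close> truncates at 0.\<close>
  finally show ?thesis
    using assms by (subst (asm) ennreal_le_iff) (auto intro!: add_nonneg_nonneg)
qed

subsection \<open>Regular grids\<close>

text \<open>The square has total mass 1, so a uniform bound also bounds the
  \<open>p\<close>-norm.\<close>

lemma per_disc_le:
  assumes "P \<subseteq> half_open_cube d" "finite P" "0 < p" "0 \<le> \<eta>"
    and "\<And>z. z \<in> unit_cube d \<times> unit_cube d \<Longrightarrow> \<bar>box_disc d P a z\<bar> \<le> \<eta>"
  shows "per_disc p d P a \<le> \<eta>"
proof -
  let ?Q = "unit_cube d \<times> unit_cube d" and ?M = "leb d \<Otimes>\<^sub>M leb d"
  have int: "integrable ?M (\<lambda>z. indicator ?Q z * \<eta> powr p)"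
    by (intro integrable_mult_left integrable_real_indicator)
      (simp_all add: emeasure_unit_cube_square)
  have "(\<integral>z. indicator ?Q z * \<bar>box_disc d P a z\<bar> powr p \<partial>?M) \<le> (\<integral>z. indicator ?Q z * \<eta> powr p \<partial>?M)"
    using assms
    by (intro integral_mono integrable_box_disc_powr int) (auto intro: powr_mono2 split: split_indicator)
  also have "\<dots> = \<eta> powr p"
    by (simp add: measure_def emeasure_unit_cube_square)
  finally have "per_disc p d P a \<le> (\<eta> powr p) powr (1 / p)"
    unfolding per_disc_eq[OF assms(1)]
    using assms by (intro powr_mono2 Bochner_Integration.integral_nonneg) auto
  with assms show ?thesis by (simp add: powr_powr)
qed

text \<open>The grid points below \<open>y\<close> are those with \<open>j\<close> less than the
  ceiling of \<open>m * y\<close>. As \<open>y\<close> is at most 1, this ceiling is at most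
  \<open>m\<close>, so it is the exact count.\<close>

lemma card_grid_less:
  fixes y :: real
  assumes "0 < m" "y \<in> {0..1}"
  shows "\<bar>real (card {j. j < m \<and> real j / real m < y}) / real m - y\<bar> \<le> 1 / real m"
proof -
  have "\<lceil>real m * y\<rceil> \<le> int m"
    using assms by (simp add: ceiling_le_iff mult_left_le)
  have "{j. j < m \<and> real j / real m < y} = {..<nat \<lceil>real m * y\<rceil>}"
  proof (intro set_eqI)
    fix j
    have "real j / real m < y \<longleftrightarrow> int j < \<lceil>real m * y\<rceil>"
      using assms by (simp add: less_ceiling_iff field_simps)
    then show "j \<in> {j. j < m \<and> real j / real m < y} \<longleftrightarrow> j \<in> {..<nat \<lceil>real m * y\<rceil>}"
      using \<open>\<lceil>real m * y\<rceil> \<le> int m\<close> by auto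
  qed
  moreover have "0 \<le> real m * y"
    using assms by simp
  then have "0 \<le> \<lceil>real m * y\<rceil>"
    by linarith
  ultimately have "real (card {j. j < m \<and> real j / real m < y}) = of_int \<lceil>real m * y\<rceil>"
    by simp
  then have "\<bar>real (card {j. j < m \<and> real j / real m < y}) - real m * y\<bar> \<le> 1"
    using ceiling_correct[of "real m * y"] by linarith
  moreover have "real (card {j. j < m \<and> real j / real m < y}) / real m - y
      = (real (card {j. j < m \<and> real j / real m < y}) - real m * y) / real m"
    using assms(1) by (simp add: diff_divide_distrib)
  ultimately show ?thesis
    by (simp add: abs_divide divide_right_mono)
qed

text \<open>On \<open>[0,1)\<close> the indicator of an arc is a difference of indicators of initial
  segments, plus 1 if the arc wraps round; \<open>arc_len\<close> satisfies the same identity. Each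
  endpoint thus costs one error of \<open>1 / m\<close>.\<close>

lemma grid_sum_per_interval:
  fixes x y :: real
  assumes "0 < m" "x \<in> {0..1}" "y \<in> {0..1}"
  shows "\<bar>(\<Sum>j<m. indicator (per_interval x y) (real j / real m)) / real m - arc_len x y\<bar> \<le> 2 / real m"
proof -
  define F where "F u = real (card {j. j < m \<and> real j / real m < u})" for u :: real
  have F: "F u = (\<Sum>j<m. if real j / real m < u then 1 else 0)" for u
    by (simp add: F_def sum.If_cases lessThan_def Int_def)
  let ?c = "if x \<le> y then 0 else 1 :: real"
  have "indicator (per_interval x y) s =
      (if s < y then 1 else 0) - (if s < x then 1 else 0) + ?c" if "0 \<le> s" "s < 1" for s :: real
    using that by (auto simp: per_interval_def indicator_def)
  then have "(\<Sum>j<m. indicator (per_interval x y) (real j / real m)) =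
      (\<Sum>j<m. (if real j / real m < y then 1 else 0) - (if real j / real m < x then 1 else 0) + ?c)"
    using assms(1) by (intro sum.cong) auto
  also have "\<dots> = F y - F x + real m * ?c"
    unfolding F by (simp only: sum.distrib sum_subtractf sum_constant card_lessThan)
  finally have "(\<Sum>j<m. indicator (per_interval x y) (real j / real m)) / real m =
      F y / real m - F x / real m + ?c"
    using assms(1) by (simp add: add_divide_distrib diff_divide_distrib)
  moreover have "\<bar>F u / real m - u\<bar> \<le> 1 / real m" if "u \<in> {0..1}" for u
    using card_grid_less[OF assms(1) that] by (simp add: F_def)
  note this[OF assms(2)] this[OF assms(3)]
  moreover have "arc_len x y = y - x + ?c"
    by (simp add: arc_len_def)
  ultimately show ?thesis by linarith
qed

definition regular_grid :: "nat \<Rightarrow> nat \<Rightarrow> (nat \<Rightarrow> real) set"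
  where "regular_grid m d = Pi\<^sub>E {..<d} (\<lambda>_. (\<lambda>j. real j / real m) ` {..<m})"

lemma regular_grid:
  assumes "0 < m"
  shows "regular_grid m d \<subseteq> half_open_cube d" "finite (regular_grid m d)"
    "card (regular_grid m d) = m ^ d"
proof -
  show "regular_grid m d \<subseteq> half_open_cube d"
    unfolding regular_grid_def half_open_cube_def by (rule PiE_mono) auto
  show "finite (regular_grid m d)"
    unfolding regular_grid_def by (intro finite_PiE) auto
  have "inj_on (\<lambda>j. real j / real m) {..<m}"
    using assms by (auto simp: inj_on_def)
  then show "card (regular_grid m d) = m ^ d"
    by (simp add: regular_grid_def card_PiE card_image)
qed

text \<open>With equal weights the count factors into coordinate averages, so the discrepancy is a
  difference of two products with factors in the unit interval. Such a difference is at most the sum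
  of the coordinate errors.\<close>

lemma box_disc_regular_grid:
  assumes "0 < m" "z \<in> unit_cube d \<times> unit_cube d"
  shows "\<bar>box_disc d (regular_grid m d) (\<lambda>_. (1 / real m) ^ d) z\<bar> \<le> 2 * real d / real m"
proof -
  let ?I = "\<lambda>i. per_interval (fst z i) (snd z i)"
  let ?G = "(\<lambda>j. real j / real m) ` {..<m}"
  let ?u = "\<lambda>i. (\<Sum>j<m. indicator (?I i) (real j / real m)) / real m"
  have inj: "inj_on (\<lambda>j. real j / real m) {..<m}"
    using assms by (auto simp: inj_on_def)
  have "(\<Sum>w\<in>regular_grid m d. (1 / real m) ^ d * box_hit d w z)
      = (\<Sum>w\<in>Pi\<^sub>E {..<d} (\<lambda>_. ?G). \<Prod>i<d. 1 / real m * indicator (?I i) (w i))"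
    by (simp only: regular_grid_def box_hit_def prod.distrib prod_constant card_lessThan)
  also have "\<dots> = (\<Prod>i<d. \<Sum>s\<in>?G. 1 / real m * indicator (?I i) s)"
    by (rule prod_sum_PiE[symmetric]) auto
  also have "\<dots> = (\<Prod>i<d. ?u i)"
    by (simp add: sum.reindex[OF inj] sum_divide_distrib)
  finally have "\<bar>box_disc d (regular_grid m d) (\<lambda>_. (1 / real m) ^ d) z\<bar>
      = norm ((\<Prod>i<d. ?u i) - (\<Prod>i<d. arc_len (fst z i) (snd z i)))"
    by (simp add: box_disc_def box_volume_def)
  also have "\<dots> \<le> (\<Sum>i<d. norm (?u i - arc_len (fst z i) (snd z i)))"
  proof (rule norm_prod_diff)
    fix i assume i: "i \<in> {..<d}"
    have "(\<Sum>j<m. indicator (?I i) (real j / real m)) \<le> (\<Sum>j<m. 1 :: real)"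
      by (intro sum_mono) (simp add: indicator_le_1)
    moreover have "0 \<le> (\<Sum>j<m. indicator (?I i) (real j / real m) :: real)"
      by (intro sum_nonneg) simp
    ultimately show "norm (?u i) \<le> 1"
      using assms(1) by simp
    show "norm (arc_len (fst z i) (snd z i)) \<le> 1"
      using arc_len_unit_cube_bounds[of "fst z" d "snd z" i] assms(2) i by (simp add: mem_Times_iff)
  qed
  also have "\<dots> \<le> (\<Sum>i<d. 2 / real m)"
  proof (rule sum_mono)
    fix i assume "i \<in> {..<d}"
    then have "fst z i \<in> {0..1}" "snd z i \<in> {0..1}"
      using assms(2) by (auto simp only: mem_Times_iff unit_cube_def dest: PiE_mem)
    then show "norm (?u i - arc_len (fst z i) (snd z i)) \<le> 2 / real m"
      unfolding real_norm_def by (rule grid_sum_per_interval[OF assms(1)])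
  qed
  finally show ?thesis by (simp add: mult.commute)
qed

lemma min_per_disc_nonneg_le:
  assumes "P \<subseteq> half_open_cube d" "finite P" "\<And>z. z \<in> P \<Longrightarrow> 0 \<le> a z"
  shows "min_per_disc_nonneg p (card P) d \<le> per_disc p d P a"
  unfolding min_per_disc_nonneg_def
proof (rule cInf_lower)
  show "bdd_below {per_disc p d P' a | P' a. P' \<subseteq> half_open_cube d \<and> finite P' \<and>
      card P' = card P \<and> (\<forall>z\<in>P'. 0 \<le> a z)}"
    by (rule bdd_belowI[of _ 0]) (auto simp: per_disc_def)
qed (use assms in auto)

lemma min_per_disc_nonneg_small:
  assumes "0 < p" "0 < \<eta>"
  shows "\<exists>N\<ge>1. min_per_disc_nonneg p N d \<le> \<eta>"
proof -
  \<comment> \<open>The grid error \<open>2 * d / m\<close> has to fall below \<open>\<eta>\<close>;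
    the resulting number of points is \<open>m ^ d\<close>.\<close>
  obtain m where m: "2 * real d / \<eta> < real m"
    using reals_Archimedean2 by blast
  moreover have "0 \<le> 2 * real d / \<eta>"
    using assms by simp
  ultimately have "0 < m"
    by (metis le_less_trans of_nat_0_less_iff)
  let ?P = "regular_grid m d" and ?a = "\<lambda>_ :: nat \<Rightarrow> real. (1 / real m) ^ d"
  note P = regular_grid[OF \<open>0 < m\<close>, of d]
  have "min_per_disc_nonneg p (card ?P) d \<le> per_disc p d ?P ?a"
    by (rule min_per_disc_nonneg_le) (use P in auto)
  also have "\<dots> \<le> 2 * real d / real m"
    by (rule per_disc_le[OF P(1,2) assms(1)]) (use box_disc_regular_grid[OF \<open>0 < m\<close>] in auto)
  also have "\<dots> \<le> \<eta>"
    using m \<open>0 < m\<close> assms by (simp add: field_simps)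
  finally show ?thesis
    using \<open>0 < m\<close> by (intro exI[of _ "card ?P"]) (simp add: P)
qed

subsection \<open>The inverse of the discrepancy\<close>

text \<open>Coordinate 0 already maps onto \<open>[0,1)\<close>. Infinitude provides point sets of
  every finite size, so the infimum in \<open>min_per_disc_nonneg\<close> is over a nonempty
  set.\<close>

lemma infinite_half_open_cube:
  assumes "1 \<le> d"
  shows "infinite (half_open_cube d)"
proof
  assume "finite (half_open_cube d)"
  then have "finite ((\<lambda>w. w 0) ` half_open_cube d)" by simp
  moreover have "{0..<1} \<subseteq> (\<lambda>w. w 0) ` half_open_cube d"
  proof
    fix s :: real assume "s \<in> {0..<1}"
    then have "(\<lambda>i\<in>{..<d}. s) \<in> half_open_cube d"
      by (simp add: half_open_cube_def)
    moreover have "(\<lambda>i\<in>{..<d}. s) 0 = s"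
      using assms by simp
    ultimately show "s \<in> (\<lambda>w. w 0) ` half_open_cube d" by (metis imageI)
  qed
  ultimately have "finite {0..<1::real}"
    by (rule rev_finite_subset)
  then show False by (simp add: infinite_Ico)
qed

text \<open>The lower bound for the integral depends on \<open>P\<close> only through its size, so
  it passes to the infimum. It is negative for large \<open>N\<close>; \<open>max 0\<close> keeps
  the base of \<open>powr\<close> nonnegative.\<close>

lemma min_per_disc_nonneg_ge:
  assumes "1 \<le> d" "0 < p"
  shows "max 0 ((1 / (p + 1)) ^ d - real N * (1 / (p + 2)) ^ d) powr (1 / p) \<le> min_per_disc_nonneg p N d"
  unfolding min_per_disc_nonneg_def
proof (rule cInf_greatest)
  obtain P where "P \<subseteq> half_open_cube d" "finite P" "card P = N"
    using infinite_arbitrarily_large[OF infinite_half_open_cube[OF assms(1)]] by metis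
  then show "{per_disc p d P a | P a. P \<subseteq> half_open_cube d \<and> finite P \<and> card P = N \<and> (\<forall>z\<in>P. 0 \<le> a z)} \<noteq> {}"
    by (auto intro!: exI[of _ P] exI[of _ "\<lambda>_. 0"])
next
  fix D assume "D \<in> {per_disc p d P a | P a.
      P \<subseteq> half_open_cube d \<and> finite P \<and> card P = N \<and> (\<forall>z\<in>P. 0 \<le> a z)}"
  then obtain P a where P: "D = per_disc p d P a" "P \<subseteq> half_open_cube d" "finite P" "card P = N"
    by blast
  show "max 0 ((1 / (p + 1)) ^ d - real N * (1 / (p + 2)) ^ d) powr (1 / p) \<le> D"
    unfolding P(1) per_disc_eq[OF P(2)]
    using integral_box_disc_powr_ge[OF P(2,3) assms(2), of a] assms P(4)
    by (intro powr_mono2 max.boundedI Bochner_Integration.integral_nonneg) auto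
qed

lemma inverse_per_disc_nonneg_ge:
  assumes "1 \<le> d" "1 < p" "0 < \<epsilon>" "\<epsilon> < 1"
  shows "((p + 2) / (p + 1)) ^ d * (1 - \<epsilon>) \<le> real (inverse_per_disc_nonneg p \<epsilon> d)"
proof -
  let ?N = "inverse_per_disc_nonneg p \<epsilon> d" and ?\<eta> = "\<epsilon> / (p + 1) powr (real d / p)"
  let ?L = "(1 / (p + 1)) ^ d - real ?N * (1 / (p + 2)) ^ d"
  have "\<exists>N. 1 \<le> N \<and> min_per_disc_nonneg p N d \<le> ?\<eta>"
    using min_per_disc_nonneg_small[of p ?\<eta> d] assms by auto
  then have "min_per_disc_nonneg p ?N d \<le> ?\<eta>"
    unfolding inverse_per_disc_nonneg_def by (rule LeastI2_ex) simp
  then have "max 0 ?L powr (1 / p) \<le> ?\<eta>"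
    using min_per_disc_nonneg_ge[OF assms(1), of p ?N] assms by linarith
  then have "(max 0 ?L powr (1 / p)) powr p \<le> ?\<eta> powr p"
    using assms by (intro powr_mono2) auto
  moreover have "(max 0 ?L powr (1 / p)) powr p = max 0 ?L"
    using assms by (simp add: powr_powr)
  moreover have "?\<eta> powr p = \<epsilon> powr p / (p + 1) ^ d"
    using assms by (simp add: powr_divide powr_powr powr_realpow)
  \<comment> \<open>This trades the factor \<open>1 - \<epsilon> powr p\<close> for the smaller but
    simpler \<open>1 - \<epsilon>\<close>.\<close>
  moreover have "\<epsilon> powr p \<le> \<epsilon>"
    using powr_mono'[of 1 p \<epsilon>] assms by simp
  ultimately have "?L \<le> \<epsilon> / (p + 1) ^ d"
    using assms by (smt (verit) divide_right_mono zero_less_power)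
  then have "(1 - \<epsilon>) / (p + 1) ^ d \<le> real ?N / (p + 2) ^ d"
    by (simp add: power_divide diff_divide_distrib)
  then show ?thesis
    using assms by (simp add: power_divide field_simps)
qed

theorem theorem7:
  "(\<forall>p::real. 1 < p \<longrightarrow>
      (\<exists>C::real. 1 < C \<and>
        (\<forall>d::nat. 1 \<le> d \<longrightarrow>
          (\<forall>\<epsilon>::real. 0 < \<epsilon> \<and> \<epsilon> < 1 / 2 \<longrightarrow>
            real (inverse_per_disc_nonneg p \<epsilon> d) \<ge> C ^ d * (1 - 2 * \<epsilon>))))) \<and>
   (\<forall>p::real. 1 < p \<longrightarrow> curse_of_dimensionality (inverse_per_disc_nonneg p))"
proof (intro conjI allI impI)
  fix p :: real assume p: "1 < p"
  show "\<exists>C>1. \<forall>d\<ge>1. \<forall>\<epsilon>. 0 < \<epsilon> \<and> \<epsilon> < 1 / 2 \<longrightarrow>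
      C ^ d * (1 - 2 * \<epsilon>) \<le> real (inverse_per_disc_nonneg p \<epsilon> d)"
  proof (intro exI[of _ "(p + 2) / (p + 1)"] conjI allI impI)
    show "1 < (p + 2) / (p + 1)"
      using p by simp
    fix d :: nat and \<epsilon> :: real assume "1 \<le> d" and \<epsilon>: "0 < \<epsilon> \<and> \<epsilon> < 1 / 2"
    have "((p + 2) / (p + 1)) ^ d * (1 - 2 * \<epsilon>) \<le> ((p + 2) / (p + 1)) ^ d * (1 - \<epsilon>)"
      using p \<epsilon> by (intro mult_left_mono) auto
    also have "\<dots> \<le> real (inverse_per_disc_nonneg p \<epsilon> d)"
      using inverse_per_disc_nonneg_ge \<open>1 \<le> d\<close> p \<epsilon> by simp
    finally show "((p + 2) / (p + 1)) ^ d * (1 - 2 * \<epsilon>) \<le> real (inverse_per_disc_nonneg p \<epsilon> d)" .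
  qed
next
  fix p :: real assume p: "1 < p"
  \<comment> \<open>Half of the exponential growth is given up to absorb a constant: at
    \<open>\<epsilon> = 1 / 2\<close> the lower bound is \<open>C ^ d * C ^ d / 2\<close>, which is
    at least \<open>C ^ d\<close> once \<open>C ^ d\<close> reaches 2. The bound with
    \<open>1 - \<epsilon>\<close> is used because \<open>1 - 2 * \<epsilon>\<close> vanishes
    there.\<close>
  define C where "C = sqrt ((p + 2) / (p + 1))"
  have C: "1 < C" "C ^ 2 = (p + 2) / (p + 1)"
    using p by (auto simp: C_def)
  obtain d0 where d0: "2 < C ^ d0"
    using real_arch_pow[OF C(1)] by blast
  have "C ^ d \<le> real (inverse_per_disc_nonneg p (1 / 2) d)" if "max 1 d0 \<le> d" for d
  proof -
    have "2 \<le> C ^ d"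
      using d0 power_increasing[of d0 d C] C(1) that by linarith
    then have "C ^ d * 2 \<le> C ^ d * C ^ d"
      using C(1) by (intro mult_left_mono) auto
    also have "\<dots> = ((p + 2) / (p + 1)) ^ d"
      by (simp flip: C(2) power_mult power_add add: mult_2)
    finally show ?thesis
      using inverse_per_disc_nonneg_ge[of d p "1 / 2"] p that by simp
  qed
  then have "{max 1 d0..} \<subseteq> {d. 1 \<le> d \<and> C ^ d \<le> real (inverse_per_disc_nonneg p (1 / 2) d)}"
    by auto
  then have "infinite {d. 1 \<le> d \<and> C ^ d \<le> real (inverse_per_disc_nonneg p (1 / 2) d)}"
    using infinite_Ici infinite_super by blast
  then show "curse_of_dimensionality (inverse_per_disc_nonneg p)"
    unfolding curse_of_dimensionality_def using C(1)
    by (intro exI[of _ "1 / 2"] exI[of _ C] conjI) auto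
qed

end
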